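(* Let $A$ be a commutative unital Banach algebra over $\mathbb K$ ($\mathbb K=\mathbb R$ or $\mathbb K=\mathbb C$). If $\mathbf f=(f_1,\dots,f_n)\in U_n(A)$, then the connected component $C(\mathbf f)$ of $\mathbf f$ in $U_n(A)$ equals the set $$\mathbf f\cdot\mathrm{Exp}\,\mathcal M_n(A).$$ In particular, $C(\mathbf f)$ is path-connected.
   Context: $U_n(A)$ is the set of tuples $(f_1,\dots,f_n)\in A^n$ for which there is $(x_1,\dots,x_n)\in A^n$ with $\sum_jx_jf_j=\mathbf 1$ (the identity of $A$), viewed as a topological subspace of $A^n$. $\mathcal M_n(A)$ is the set of $n\times n$ matrices over $A$, and $\mathrm{Exp}\,\mathcal M_n(A)=\{e^{M_1}\cdots e^{M_k}:k\in\mathbb N,\ M_j\in\mathcal M_n(A)\}$. $\mathbf f\cdot\mathrm{Exp}\,\mathcal M_n(A)=\{\mathbf f\,E:E\in\mathrm{Exp}\,\mathcal M_n(A)\}$, with $\mathbf f$ a row vector. *)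

theory Defs
  imports "HOL-Analysis.Analysis"
begin

text \<open>
  Commutative unital Banach algebras are modelled by the sort
  \<open>{real_normed_algebra, banach, comm_ring_1}\<close>: a complete, submultiplicative norm and a unit
  \<open>1 \<noteq> 0\<close>, without requiring \<open>norm 1 = 1\<close>.  A complex Banach algebra is an instance by
  restriction of scalars, and this loses nothing: unimodular tuples, their topology, matrices and
  the exponential series (whose coefficients are rational) do not refer to complex scalars.

  Tuples of length \<open>n\<close> and square matrices are \<open>'a ^ 'n\<close> and \<open>'a ^ 'n ^ 'n\<close> with
  \<open>n = CARD('n)\<close>; both carry the product topology.
\<close>

definition unimodular_tuples :: "('a::comm_ring_1 ^ 'n) set"
  where "unimodular_tuples = {f. \<exists>x. (\<Sum>j\<in>UNIV. x $ j * f $ j) = 1}"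

text \<open>
  The type \<open>'a ^ 'n ^ 'n\<close> already has a multiplication and a power, but these act entrywise; hence
  the separate power and exponential with respect to the matrix product.
\<close>

primrec mat_pow :: "'a::semiring_1 ^ 'n ^ 'n \<Rightarrow> nat \<Rightarrow> 'a ^ 'n ^ 'n"
  where
    "mat_pow M 0 = mat 1"
  | "mat_pow M (Suc k) = M ** mat_pow M k"

definition mat_exp ::
    "'a::{real_normed_algebra,banach,comm_ring_1} ^ 'n ^ 'n \<Rightarrow> 'a ^ 'n ^ 'n"
  where "mat_exp M = (\<Sum>k. mat_pow M k /\<^sub>R fact k)"

definition Exp_matrices ::
    "('a::{real_normed_algebra,banach,comm_ring_1} ^ 'n ^ 'n) set"
  where "Exp_matrices = {foldr (\<lambda>M E. mat_exp M ** E) Ms (mat 1) | Ms. True}"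

text \<open>The exponential series converges for every matrix, so \<open>mat_exp\<close> is its actual sum.\<close>

lemma norm_vec_le_sum: "norm (v :: 'b::real_normed_vector ^ 'n) \<le> (\<Sum>i\<in>UNIV. norm (v $ i))"
  unfolding norm_vec_def by (rule L2_set_le_sum) simp

lemma norm_matrix_matrix_mult_le:
  fixes A B :: "'a::{real_normed_algebra,comm_ring_1} ^ 'n ^ 'n"
  shows "norm (A ** B) \<le> real (CARD('n)) ^ 3 * norm A * norm B"
proof -
  have entry: "norm (C $ i $ j) \<le> norm C" for C :: "'a ^ 'n ^ 'n" and i j
    by (rule order_trans[OF Finite_Cartesian_Product.norm_nth_le Finite_Cartesian_Product.norm_nth_le])
  have prod: "norm ((A ** B) $ i $ j) \<le> real (CARD('n)) * (norm A * norm B)" for i j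
  proof -
    have "norm ((A ** B) $ i $ j) \<le> (\<Sum>k\<in>UNIV. norm (A $ i $ k * B $ k $ j))"
      by (simp add: matrix_matrix_mult_def norm_sum)
    also have "\<dots> \<le> (\<Sum>k\<in>(UNIV::'n set). norm A * norm B)"
      by (intro sum_mono order_trans[OF norm_mult_ineq] mult_mono entry) auto
    finally show ?thesis by simp
  qed
  have "norm (A ** B) \<le> (\<Sum>i\<in>UNIV. \<Sum>j\<in>UNIV. norm ((A ** B) $ i $ j))"
    by (rule order_trans[OF norm_vec_le_sum]) (intro sum_mono norm_vec_le_sum)
  also have "\<dots> \<le> (\<Sum>i\<in>(UNIV::'n set). \<Sum>j\<in>(UNIV::'n set). real (CARD('n)) * (norm A * norm B))"
    by (intro sum_mono prod)
  finally show ?thesis by (simp add: power3_eq_cube mult.assoc)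
qed

lemma summable_mat_exp:
  fixes M :: "'a::{real_normed_algebra,banach,comm_ring_1} ^ 'n ^ 'n"
  shows "summable (\<lambda>k. mat_pow M k /\<^sub>R fact k)"
proof -
  define c where "c = real (CARD('n)) ^ 3 * norm M"
  have c: "c \<ge> 0" by (simp add: c_def)
  have bound: "norm (mat_pow M k) \<le> norm (mat 1 :: 'a ^ 'n ^ 'n) * c ^ k" for k
  proof (induction k)
    case (Suc k)
    have "norm (mat_pow M (Suc k)) \<le> c * norm (mat_pow M k)"
      using norm_matrix_matrix_mult_le[of M "mat_pow M k"] by (simp add: c_def)
    also have "\<dots> \<le> c * (norm (mat 1 :: 'a ^ 'n ^ 'n) * c ^ k)"
      by (rule mult_left_mono[OF Suc c])
    finally show ?case by (simp add: mult_ac)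
  qed simp
  have "summable (\<lambda>k. norm (mat 1 :: 'a ^ 'n ^ 'n) * (c ^ k /\<^sub>R fact k))"
    by (intro summable_mult summable_exp_generic)
  then show ?thesis
    by (rule summable_comparison_test[rotated])
       (use bound in \<open>auto intro!: exI[of _ 0] simp: field_simps\<close>)
qed

end

theory Submission
  imports Defs
begin

text \<open>
  The orbits of the group of products of exponentials partition the set of unimodular tuples.
  An orbit is path-connected, since \<open>e\<^bsup>tM\<^esup>\<close> joins the identity to \<open>e\<^bsup>M\<^esup>\<close>; so it suffices
  that orbits are open. If \<open>x\<close> is a column with \<open>g x = 1\<close>, then \<open>h = g (1 + x (h - g))\<close>, and the
  rank-one perturbation \<open>1 + N\<close> of the identity, \<open>N = x (h - g)\<close>, satisfies \<open>N\<^sup>2 = c N\<close> with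
  \<open>c = h x - 1 \<in> A\<close>. Hence for small \<open>c\<close> it is a single exponential \<open>e\<^bsup>sN\<^esup>\<close> with \<open>s \<in> A\<close>.
\<close>

section \<open>The matrix exponential: absolute convergence, inverse, continuity along
  segments\<close>

lemma scaleR_matrix_mult_left:
  fixes A :: "'a::{real_algebra,ring_1} ^ 'm ^ 'n"
  shows "(c *\<^sub>R A) ** B = c *\<^sub>R (A ** B)"
  by (simp add: matrix_matrix_mult_def vec_eq_iff scaleR_sum_right)

lemma scaleR_matrix_mult_right:
  fixes A :: "'a::{real_algebra,ring_1} ^ 'm ^ 'n"
  shows "A ** (c *\<^sub>R B) = c *\<^sub>R (A ** B)"
  by (simp add: matrix_matrix_mult_def vec_eq_iff scaleR_sum_right)

lemma mat_pow_add: "mat_pow M (i + j) = mat_pow M i ** mat_pow M j"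
  by (induction i) (simp_all add: matrix_mul_assoc)

lemma mat_pow_scaleR:
  fixes M :: "'a::{real_algebra,comm_ring_1} ^ 'n ^ 'n"
  shows "mat_pow (t *\<^sub>R M) k = t ^ k *\<^sub>R mat_pow M k"
  by (induction k) (simp_all add: scaleR_matrix_mult_left scaleR_matrix_mult_right)

text \<open>The majorant that gives convergence bounds the norms as well. Absolute convergence is
  what the Cauchy product (through the entries) and the Weierstrass test ask for.\<close>

lemma summable_norm_mat_exp:
  fixes M :: "'a::{real_normed_algebra,banach,comm_ring_1} ^ 'n ^ 'n"
  shows "summable (\<lambda>k. norm (mat_pow M k /\<^sub>R fact k))"
proof -
  define c where "c = real (CARD('n)) ^ 3 * norm M"
  have c: "c \<ge> 0" by (simp add: c_def)
  have bound: "norm (mat_pow M k) \<le> norm (mat 1 :: 'a ^ 'n ^ 'n) * c ^ k" for k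
  proof (induction k)
    case (Suc k)
    have "norm (mat_pow M (Suc k)) \<le> c * norm (mat_pow M k)"
      using norm_matrix_matrix_mult_le[of M "mat_pow M k"] by (simp add: c_def)
    also have "\<dots> \<le> c * (norm (mat 1 :: 'a ^ 'n ^ 'n) * c ^ k)"
      by (rule mult_left_mono[OF Suc c])
    finally show ?case by (simp add: mult_ac)
  qed simp
  have "summable (\<lambda>k. norm (mat 1 :: 'a ^ 'n ^ 'n) * (c ^ k /\<^sub>R fact k))"
    by (intro summable_mult summable_exp_generic)
  then show ?thesis
    by (rule summable_comparison_test[rotated])
       (use bound in \<open>auto intro!: exI[of _ 0] simp: field_simps\<close>)
qed

lemma summable_norm_mat_exp_entry:
  fixes M :: "'a::{real_normed_algebra,banach,comm_ring_1} ^ 'n ^ 'n"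
  shows "summable (\<lambda>k. norm ((mat_pow M k /\<^sub>R fact k) $ i $ j))"
proof (rule summable_comparison_test[OF _ summable_norm_mat_exp[of M]], intro exI allI impI)
  fix k
  have "norm ((mat_pow M k /\<^sub>R fact k) $ i $ j) \<le> norm (mat_pow M k /\<^sub>R fact k)"
    by (rule order_trans[OF Finite_Cartesian_Product.norm_nth_le Finite_Cartesian_Product.norm_nth_le])
  then show "norm (norm ((mat_pow M k /\<^sub>R fact k) $ i $ j)) \<le> norm (mat_pow M k /\<^sub>R fact k)"
    by (simp only: real_norm_def abs_norm_cancel)
qed

lemma norm_divideR_fact: "norm (v /\<^sub>R fact k) = inverse (fact k) * norm v"
  by simp

lemma mat_exp_sums: "(\<lambda>k. mat_pow M k /\<^sub>R fact k) sums mat_exp M"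
  unfolding mat_exp_def by (rule summable_sums[OF summable_mat_exp])

lemma mat_exp_entry: "mat_exp M $ i $ j = (\<Sum>k. (mat_pow M k /\<^sub>R fact k) $ i $ j)"
  by (rule sums_unique[OF sums_vec_nth[OF sums_vec_nth[OF mat_exp_sums]]])

lemma mat_exp_0: "mat_exp (0 :: 'a::{real_normed_algebra,banach,comm_ring_1} ^ 'n ^ 'n) = mat 1"
proof -
  have "mat_pow (0 :: 'a ^ 'n ^ 'n) k = (if k = 0 then mat 1 else 0)" for k
    by (cases k) (simp_all add: matrix_matrix_mult_def vec_eq_iff)
  then have "(\<lambda>k. mat_pow (0 :: 'a ^ 'n ^ 'n) k /\<^sub>R fact k) = (\<lambda>k. if k = 0 then mat 1 else 0)"
    by auto
  then show ?thesis
    using sums_unique2[OF mat_exp_sums[of "0 :: 'a ^ 'n ^ 'n"] ]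
      sums_single[of 0 "\<lambda>_. mat 1 :: 'a ^ 'n ^ 'n"] by simp
qed

text \<open>This is the coefficient of \<open>z ^ k\<close> in the product of the series of
  \<open>exp z\<close> and \<open>exp (- z)\<close>. Multiplied by \<open>fact k\<close> it becomes
  the binomial expansion of \<open>(1 - 1) ^ k\<close>.\<close>

lemma sum_alternating_inverse_fact:
  "(\<Sum>p\<le>k. (- 1) ^ (k - p) / (fact p * fact (k - p))) = (if k = 0 then 1 else (0::real))"
proof (cases "k = 0")
  case False
  have "(\<Sum>p\<le>k. (- 1) ^ (k - p) / (fact p * fact (k - p)) :: real)
      = (\<Sum>p\<le>k. (- 1) ^ p / (fact p * fact (k - p)))"
    by (rule sum.reindex_bij_witness[of _ "\<lambda>p. k - p" "\<lambda>p. k - p"]) (auto simp: mult.commute)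
  also have "\<dots> = (\<Sum>p\<le>k. (- 1) ^ p * of_nat (k choose p)) / fact k"
    unfolding sum_divide_distrib by (intro sum.cong) (auto simp: binomial_fact field_simps)
  finally show ?thesis using False by (simp add: choose_alternating_sum)
qed simp

text \<open>In the Cauchy product of the two series, degree \<open>k\<close> contributes a real
  multiple of \<open>mat_pow M k\<close>, and the alternating sum of inverse factorials kills every
  degree except 0.\<close>

lemma mat_exp_mult_minus:
  fixes M :: "'a::{real_normed_algebra,banach,comm_ring_1} ^ 'n ^ 'n"
  shows "mat_exp M ** mat_exp (- M) = mat 1"
proof -
  define a where "a k = mat_pow M k /\<^sub>R fact k" for k
  define b where "b k = mat_pow (- M) k /\<^sub>R fact k" for k
  have conv: "(\<Sum>p\<le>k. a p ** b (k - p)) = (if k = 0 then mat 1 else 0)" for k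
  proof -
    have "a p ** b (k - p) = ((- 1) ^ (k - p) / (fact p * fact (k - p))) *\<^sub>R mat_pow M k"
      if "p \<le> k" for p
      using that mat_pow_scaleR[of "- 1" M "k - p"] mat_pow_add[of M p "k - p"]
      by (simp add: a_def b_def scaleR_matrix_mult_left scaleR_matrix_mult_right field_simps)
    then have "(\<Sum>p\<le>k. a p ** b (k - p))
        = (\<Sum>p\<le>k. ((- 1) ^ (k - p) / (fact p * fact (k - p))) *\<^sub>R mat_pow M k)"
      by (intro sum.cong) auto
    also have "\<dots> = (\<Sum>p\<le>k. (- 1) ^ (k - p) / (fact p * fact (k - p))) *\<^sub>R mat_pow M k"
      by (rule scaleR_left.sum[symmetric])
    finally show ?thesis by (simp add: sum_alternating_inverse_fact)
  qed
  have "(mat_exp M ** mat_exp (- M)) $ i $ j = (mat 1 :: 'a ^ 'n ^ 'n) $ i $ j" for i j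
  proof -
    \<comment> \<open>The Cauchy product theorem concerns \<open>*\<close>, which is entrywise on
      matrices. It is therefore applied in the algebra, to one pair of entries for each inner index
      \<open>l\<close>, and then summed over \<open>l\<close>.\<close>
    have "(\<lambda>k. \<Sum>p\<le>k. a p $ i $ l * b (k - p) $ l $ j) sums (mat_exp M $ i $ l * mat_exp (- M) $ l $ j)" for l
      unfolding mat_exp_entry a_def b_def
      by (intro Cauchy_product_sums summable_norm_mat_exp_entry)
    then have "(\<lambda>k. \<Sum>l\<in>UNIV. \<Sum>p\<le>k. a p $ i $ l * b (k - p) $ l $ j)
        sums (\<Sum>l\<in>UNIV. mat_exp M $ i $ l * mat_exp (- M) $ l $ j)"
      by (intro sums_sum)
    moreover have "(\<Sum>l\<in>UNIV. \<Sum>p\<le>k. a p $ i $ l * b (k - p) $ l $ j)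
        = (if k = 0 then mat 1 $ i $ j else 0)" for k
    proof -
      have "(\<Sum>l\<in>UNIV. \<Sum>p\<le>k. a p $ i $ l * b (k - p) $ l $ j) = (\<Sum>p\<le>k. a p ** b (k - p)) $ i $ j"
        by (subst sum.swap) (simp add: matrix_matrix_mult_def)
      then show ?thesis by (simp add: conv)
    qed
    ultimately have "(\<lambda>k. if k = 0 then (mat 1 :: 'a ^ 'n ^ 'n) $ i $ j else 0)
        sums (mat_exp M ** mat_exp (- M)) $ i $ j"
      by (simp add: matrix_matrix_mult_def)
    with sums_single[of 0 "\<lambda>_. (mat 1 :: 'a ^ 'n ^ 'n) $ i $ j"] show ?thesis
      by (metis (no_types) sums_unique2)
  qed
  then show ?thesis by (simp add: vec_eq_iff)
qed

text \<open>For \<open>t\<close> in the unit interval the terms of the series are dominated by those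
  at \<open>t = 1\<close>, so the partial sums converge uniformly.\<close>

lemma continuous_on_mat_exp_line:
  fixes M :: "'a::{real_normed_algebra,banach,comm_ring_1} ^ 'n ^ 'n"
  shows "continuous_on {0..1} (\<lambda>t. mat_exp (t *\<^sub>R M))"
proof -
  have "uniform_limit {0..1} (\<lambda>n t. \<Sum>k<n. t ^ k *\<^sub>R (mat_pow M k /\<^sub>R fact k))
      (\<lambda>t. \<Sum>k. t ^ k *\<^sub>R (mat_pow M k /\<^sub>R fact k)) sequentially"
  proof (rule Weierstrass_m_test[OF _ summable_norm_mat_exp[of M]])
    fix n and t :: real assume "t \<in> {0..1}"
    then show "norm (t ^ n *\<^sub>R (mat_pow M n /\<^sub>R fact n)) \<le> norm (mat_pow M n /\<^sub>R fact n)"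
      by (simp add: power_le_one mult_left_le_one_le)
  qed
  then have "continuous_on {0..1} (\<lambda>t. \<Sum>k. t ^ k *\<^sub>R (mat_pow M k /\<^sub>R fact k))"
    by (rule uniform_limit_theorem[rotated]) (auto intro!: always_eventually continuous_intros)
  then show ?thesis
    by (simp add: mat_exp_def mat_pow_scaleR mult.commute)
qed

section \<open>Products of exponentials\<close>

abbreviation exp_prod ::
    "('a::{real_normed_algebra,banach,comm_ring_1} ^ 'n ^ 'n) list \<Rightarrow> 'a ^ 'n ^ 'n"
  where "exp_prod Ms \<equiv> foldr (\<lambda>M E. mat_exp M ** E) Ms (mat 1)"

lemma exp_prod_append: "exp_prod (Ms @ Ns) = exp_prod Ms ** exp_prod Ns"
  by (induction Ms) (simp_all add: matrix_mul_assoc)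

text \<open>Negating the exponents and reversing their order makes the factors cancel in pairs from
  the middle outwards.\<close>

lemma exp_prod_inverse: "exp_prod Ms ** exp_prod (rev (map uminus Ms)) = mat 1"
proof (induction Ms)
  case (Cons M Ms)
  have "exp_prod (M # Ms) ** exp_prod (rev (map uminus (M # Ms)))
      = mat_exp M ** (exp_prod Ms ** exp_prod (rev (map uminus Ms))) ** mat_exp (- M)"
    by (simp only: list.map rev.simps exp_prod_append foldr.simps o_apply id_apply matrix_mul_rid matrix_mul_assoc)
  then show ?case using Cons by (simp add: mat_exp_mult_minus)
qed simp

lemma Exp_matrices_mult:
  assumes "E \<in> Exp_matrices" "F \<in> Exp_matrices"
  shows "E ** F \<in> Exp_matrices"
proof -
  obtain Ms Ns where "E = exp_prod Ms" "F = exp_prod Ns"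
    using assms unfolding Exp_matrices_def by blast
  then have "E ** F = exp_prod (Ms @ Ns)" by (simp only: exp_prod_append)
  then show ?thesis unfolding Exp_matrices_def by blast
qed

lemma Exp_matrices_inverse:
  assumes "E \<in> Exp_matrices"
  obtains F where "F \<in> Exp_matrices" "E ** F = mat 1"
  using assms exp_prod_inverse unfolding Exp_matrices_def by blast

lemma mat_exp_in_Exp_matrices: "mat_exp M \<in> Exp_matrices"
proof -
  have "mat_exp M = exp_prod [M]" by simp
  then show ?thesis unfolding Exp_matrices_def by blast
qed

lemma continuous_on_matrix_mult:
  fixes A :: "'b::topological_space \<Rightarrow> 'a::{real_normed_algebra,ring_1} ^ 'm ^ 'n"
  assumes "continuous_on S A" "continuous_on S B"
  shows "continuous_on S (\<lambda>t. A t ** B t)"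
  unfolding matrix_matrix_mult_def
  by (intro continuous_on_vec_lambda continuous_intros assms)

lemma continuous_on_vector_matrix_mult:
  fixes A :: "'b::topological_space \<Rightarrow> 'a::{real_normed_algebra,ring_1} ^ 'm ^ 'n"
  assumes "continuous_on S A"
  shows "continuous_on S (\<lambda>t. v v* A t)"
  unfolding vector_matrix_mult_def
  by (intro continuous_on_vec_lambda continuous_intros assms)

text \<open>Scaling all exponents by the same \<open>t\<close> gives a path from
  \<open>mat 1\<close> to \<open>exp_prod Ms\<close> that runs inside
  \<open>Exp_matrices\<close>.\<close>

lemma continuous_on_exp_prod_line:
  "continuous_on {0..1} (\<lambda>t. exp_prod (map ((*\<^sub>R) t) Ms))"
  by (induction Ms) (auto intro!: continuous_on_matrix_mult continuous_on_mat_exp_line)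

lemma exp_prod_line_0: "exp_prod (map ((*\<^sub>R) 0) Ms) = mat 1"
  by (induction Ms) (simp_all add: mat_exp_0)

text \<open>If \<open>x\<close> is a witness for \<open>g\<close> and \<open>E ** F = mat 1\<close>,
  then \<open>F *v x\<close> is a witness for \<open>g v* E\<close>, because
  \<open>(g E) (F x) = g x\<close>.\<close>

lemma unimodular_tuples_mult_Exp:
  assumes "g \<in> unimodular_tuples" "E \<in> Exp_matrices"
  shows "g v* E \<in> unimodular_tuples"
proof -
  obtain F where F: "E ** F = mat 1" using Exp_matrices_inverse[OF assms(2)] .
  obtain x where x: "(\<Sum>j\<in>UNIV. x $ j * g $ j) = 1"
    using assms(1) by (auto simp: unimodular_tuples_def)
  have "(\<Sum>j\<in>UNIV. (F *v x) $ j * (g v* E) $ j) = (\<Sum>i\<in>UNIV. x $ i * (g v* E v* F) $ i)"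
    by (simp add: matrix_vector_mult_def vector_matrix_mult_def sum_distrib_left sum_distrib_right mult_ac)
       (rule sum.swap)
  also have "\<dots> = 1"
    by (simp add: vector_matrix_mul_assoc F x)
  finally show ?thesis unfolding unimodular_tuples_def by blast
qed

section \<open>Exponentials of matrices of rank one\<close>

text \<open>Exponents start at 1 because \<open>norm 1\<close> may exceed 1, so the bound can fail
  for \<open>s ^ 0\<close>.\<close>

lemma norm_power_Suc_le:
  fixes s :: "'a::{real_normed_algebra,comm_ring_1}"
  assumes "norm s \<le> R"
  shows "norm (s ^ Suc k) \<le> R ^ Suc k"
proof (induction k)
  case (Suc k)
  have "norm (s ^ Suc (Suc k)) \<le> norm s * norm (s ^ Suc k)"
    using norm_mult_ineq[of s "s ^ Suc k"] by simp
  also have "\<dots> \<le> R * R ^ Suc k"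
    using assms Suc by (intro mult_mono) (auto intro: order_trans[OF norm_ge_zero])
  finally show ?case by simp
qed (use assms in simp)

text \<open>A Lipschitz bound on the ball of radius \<open>R\<close>, by the product rule for
  differences. The factor \<open>Suc k\<close>, as in a derivative, is later absorbed by a
  factorial.\<close>

lemma norm_power_Suc_diff_le:
  fixes s t :: "'a::{real_normed_algebra,comm_ring_1}"
  assumes "norm s \<le> R" "norm t \<le> R"
  shows "norm (s ^ Suc k - t ^ Suc k) \<le> real (Suc k) * R ^ k * norm (s - t)"
proof (induction k)
  case (Suc k)
  have R: "0 \<le> R" using assms(1) norm_ge_zero order_trans by blast
  have "s ^ Suc (Suc k) - t ^ Suc (Suc k) = s * (s ^ Suc k - t ^ Suc k) + (s - t) * t ^ Suc k"
    by (simp add: algebra_simps)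
  then have "norm (s ^ Suc (Suc k) - t ^ Suc (Suc k))
      \<le> norm s * norm (s ^ Suc k - t ^ Suc k) + norm (s - t) * norm (t ^ Suc k)"
    by (metis add_mono norm_mult_ineq norm_triangle_le)
  also have "\<dots> \<le> R * (real (Suc k) * R ^ k * norm (s - t)) + norm (s - t) * R ^ Suc k"
    by (intro add_mono mult_mono assms Suc R norm_power_Suc_le) auto
  finally show ?case by (simp add: algebra_simps)
qed simp

text \<open>The extra factor \<open>a\<close> makes the exponent 0 harmless although
  \<open>norm 1\<close> is not assumed to be 1.\<close>

lemma norm_mult_power_le:
  fixes a c :: "'a::{real_normed_algebra,comm_ring_1}"
  shows "norm (a * c ^ k) \<le> norm a * norm c ^ k"
proof (induction k)
  case (Suc k)
  have "norm (a * c ^ Suc k) \<le> norm (a * c ^ k) * norm c"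
    using norm_mult_ineq[of "a * c ^ k" c] by (simp add: mult_ac)
  also have "\<dots> \<le> norm a * norm c ^ k * norm c"
    by (intro mult_right_mono Suc) auto
  finally show ?case by (simp add: mult_ac)
qed simp

text \<open>The solution is \<open>s = log (1 + c) / c\<close>, obtained as a fixed point so that no
  composition of power series is needed.\<close>

lemma exists_log_quotient:
  "\<exists>\<delta>>0. \<forall>c::'a::{real_normed_algebra,banach,comm_ring_1}. norm c < \<delta> \<longrightarrow>
     (\<exists>s. (\<lambda>k. (s ^ Suc k * c ^ k) /\<^sub>R fact (Suc k)) sums 1)"
proof -
  \<comment> \<open>The map \<open>T\<close> below subtracts from 1 a sum of norm at most 1, so it
    preserves the closed ball of this radius.\<close>
  define R where "R = norm (1::'a) + 1"
  have R: "R \<ge> 1" by (simp add: R_def)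
  \<comment> \<open>This one smallness condition serves twice: it bounds the sum in \<open>T\<close>
    by 1 and, as \<open>R \<ge> 1\<close>, makes \<open>T\<close> a contraction with constant
    1/2.\<close>
  have "((\<lambda>d. R * (exp (R * d) - 1)) \<longlongrightarrow> R * (exp (R * 0) - 1)) (at_right 0)"
    by (intro tendsto_intros)
  then have "\<forall>\<^sub>F d in at_right 0. R * (exp (R * d) - 1) < 1 / 2"
    by (rule order_tendstoD) simp
  then obtain \<delta> where \<delta>: "\<delta> > 0" "\<And>d. 0 < d \<Longrightarrow> d < \<delta> \<Longrightarrow> R * (exp (R * d) - 1) < 1 / 2"
    unfolding eventually_at_right_field by auto
  have "\<exists>s. (\<lambda>k. (s ^ Suc k * c ^ k) /\<^sub>R fact (Suc k)) sums 1" if c: "norm c < \<delta>" for c :: 'a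
  proof -
    define d where "d = norm c"
    define L where "L = exp (R * d) - 1"
    have d: "0 \<le> d" by (simp add: d_def)
    have L0: "0 \<le> L" using R d by (simp add: L_def)
    \<comment> \<open>The one-sided limit speaks only of \<open>d > 0\<close>; for
      \<open>d = 0\<close> the left side vanishes.\<close>
    have RL: "R * L < 1 / 2"
      using \<delta>(2)[of d] c by (cases "d = 0") (auto simp: d_def L_def)
    have L: "L < 1 / 2"
      using RL R L0 mult_right_mono[of 1 R L] by simp
    \<comment> \<open>The terms of \<open>exp (R * d) - 1\<close>, the common majorant for the
      estimates on \<open>u\<close>.\<close>
    define e where "e k = (R * d) ^ Suc k /\<^sub>R fact (Suc k)" for k
    have "(\<lambda>k. (R * d) ^ k /\<^sub>R fact k) sums exp (R * d)"
      by (rule exp_converges)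
    then have e: "e sums L"
      unfolding e_def L_def by (subst sums_Suc_iff) simp
    \<comment> \<open>The desired series without its first term, which is \<open>s\<close> itself.
      Hence the series has sum 1 exactly when \<open>T s = s\<close>.\<close>
    define u where "u s k = (s ^ Suc (Suc k) * c ^ Suc k) /\<^sub>R fact (Suc (Suc k))" for s k
    define T where "T s = 1 - (\<Sum>k. u s k)" for s
    have fact_le: "inverse (fact (Suc (Suc k))) \<le> (inverse (fact (Suc k)) :: real)" for k
      by (intro le_imp_inverse_le fact_mono) auto
    have u: "norm (u s k) \<le> R * e k" if s: "norm s \<le> R" for s k
    proof -
      have "norm (s ^ Suc (Suc k) * c ^ Suc k) \<le> R ^ Suc (Suc k) * d ^ Suc k"
        using R unfolding d_def
        by (intro order_trans[OF norm_mult_power_le] mult_right_mono norm_power_Suc_le s) auto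
      then have "norm (u s k) \<le> inverse (fact (Suc k)) * (R ^ Suc (Suc k) * d ^ Suc k)"
        unfolding u_def norm_divideR_fact
        by (intro mult_mono fact_le) auto
      then show ?thesis by (simp add: e_def power_mult_distrib mult_ac)
    qed
    have u_diff: "norm (u s k - u t k) \<le> e k * norm (s - t)" if s: "norm s \<le> R" "norm t \<le> R" for s t k
    proof -
      have "norm ((s ^ Suc (Suc k) - t ^ Suc (Suc k)) * c ^ Suc k)
          \<le> real (Suc (Suc k)) * R ^ Suc k * norm (s - t) * d ^ Suc k"
        unfolding d_def
        by (intro order_trans[OF norm_mult_power_le] mult_right_mono norm_power_Suc_diff_le s) auto
      moreover have "u s k - u t k = ((s ^ Suc (Suc k) - t ^ Suc (Suc k)) * c ^ Suc k) /\<^sub>R fact (Suc (Suc k))"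
        by (simp only: u_def left_diff_distrib scaleR_right_diff_distrib)
      ultimately have "norm (u s k - u t k) \<le> inverse (fact (Suc (Suc k))) *
          (real (Suc (Suc k)) * R ^ Suc k * norm (s - t) * d ^ Suc k)"
        by (simp only: norm_divideR_fact) (intro mult_left_mono, auto)
      also have "\<dots> = (inverse (fact (Suc (Suc k))) * real (Suc (Suc k))) *
          (R ^ Suc k * norm (s - t) * d ^ Suc k)"
        by (simp only: mult_ac)
      \<comment> \<open>The Lipschitz factor cancels the top factor of the factorial, so
        \<open>e\<close> majorises the differences too, this time without the extra
        \<open>R\<close>.\<close>
      also have "inverse (fact (Suc (Suc k))) * real (Suc (Suc k)) = inverse (fact (Suc k))"
        by (simp add: fact_Suc[of "Suc k"] del: fact_Suc of_nat_Suc)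
      finally show ?thesis by (simp add: e_def power_mult_distrib mult_ac)
    qed
    have eR: "(\<lambda>k. R * e k) sums (R * L)" by (intro sums_mult e)
    have summable_u: "summable (u s)" if "norm s \<le> R" for s
      by (rule summable_comparison_test[OF _ sums_summable[OF eR]]) (use u that in auto)
    have "\<exists>!s\<in>cball 0 R. T s = s"
    proof (rule Banach_fix[where c = "1 / 2"])
      show "complete (cball (0::'a) R)" by (simp add: complete_eq_closed)
      show "cball (0::'a) R \<noteq> {}" using R by simp
      have "norm (T s) \<le> R" if s: "norm s \<le> R" for s
      proof -
        have "norm (\<Sum>k. u s k) \<le> (\<Sum>k. R * e k)"
          by (rule norm_suminf_le) (use u s eR in \<open>auto simp: sums_iff\<close>)
        then have "norm (\<Sum>k. u s k) \<le> 1"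
          using eR RL by (simp add: sums_iff)
        then show ?thesis
          unfolding T_def R_def using norm_triangle_ineq4[of 1 "\<Sum>k. u s k"] by simp
      qed
      then show "T ` cball 0 R \<subseteq> cball 0 R" by auto
      fix s t :: 'a assume "s \<in> cball 0 R" "t \<in> cball 0 R"
      then have st: "norm s \<le> R" "norm t \<le> R" by auto
      have et: "(\<lambda>k. e k * norm (s - t)) sums (L * norm (s - t))" by (intro sums_mult2 e)
      have "dist (T s) (T t) = norm (\<Sum>k. u s k - u t k)"
        unfolding T_def dist_norm suminf_diff[OF summable_u[OF st(1)] summable_u[OF st(2)], symmetric]
        by (simp add: norm_minus_commute)
      also have "\<dots> \<le> L * norm (s - t)"
        using norm_suminf_le[OF _ sums_summable[OF et], of "\<lambda>k. u s k - u t k"] u_diff st et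
        by (simp add: sums_iff)
      also have "\<dots> \<le> 1 / 2 * dist s t"
        unfolding dist_norm using L by (intro mult_right_mono) auto
      finally show "dist (T s) (T t) \<le> 1 / 2 * dist s t" .
    qed auto
    then obtain s where s: "norm s \<le> R" "T s = s" by auto
    have "u s sums (1 - s)"
      using summable_sums[OF summable_u[OF s(1)]] s(2) unfolding T_def by (metis add_diff_cancel_left' diff_add_cancel)
    then have "(\<lambda>k. (s ^ Suc k * c ^ k) /\<^sub>R fact (Suc k)) sums (1 - s + s)"
      unfolding u_def by (subst (asm) sums_Suc_iff) simp
    then show ?thesis by auto
  qed
  with \<delta>(1) show ?thesis by blast
qed

text \<open>Writing \<open>N\<close> for the matrix with entries \<open>x $ i * y $ j\<close>, the
  relation \<open>N ** N = c N\<close> gives \<open>(s N)^(k+1) = s^(k+1) c^k N\<close>. The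
  exponential series of \<open>s N\<close> thus collapses to \<open>1 + N\<close> times the scalar
  series, whose sum is 1.\<close>

lemma mat_exp_rank_one:
  fixes x y :: "'a::{real_normed_algebra,banach,comm_ring_1} ^ 'n"
  assumes "c = (\<Sum>j\<in>UNIV. y $ j * x $ j)"
    and "(\<lambda>k. (s ^ Suc k * c ^ k) /\<^sub>R fact (Suc k)) sums 1"
  shows "mat_exp (\<chi> i j. s * (x $ i * y $ j)) = mat 1 + (\<chi> i j. x $ i * y $ j)"
proof -
  define M where "M = (\<chi> i j. s * (x $ i * y $ j))"
  have pow: "mat_pow M (Suc k) = (\<chi> i j. s ^ Suc k * c ^ k * (x $ i * y $ j))" for k
  proof (induction k)
    case (Suc k)
    have "(M ** mat_pow M (Suc k)) $ i $ j = s ^ Suc (Suc k) * c ^ Suc k * (x $ i * y $ j)" for i j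
      unfolding Suc
      by (simp add: M_def matrix_matrix_mult_def assms(1) sum_distrib_left sum_distrib_right mult_ac)
    then show ?case by (simp add: vec_eq_iff)
  qed (simp add: M_def)
  have "mat_exp M $ i $ j = (mat 1 + (\<chi> i j. x $ i * y $ j)) $ i $ j" for i j
  proof -
    have "(\<lambda>k. (s ^ Suc k * c ^ k) /\<^sub>R fact (Suc k) * (x $ i * y $ j)) sums (1 * (x $ i * y $ j))"
      by (intro sums_mult2 assms)
    then have "(\<lambda>k. (mat_pow M (Suc k) /\<^sub>R fact (Suc k)) $ i $ j) sums (x $ i * y $ j)"
      unfolding pow by simp
    then have "(\<lambda>k. (mat_pow M k /\<^sub>R fact k) $ i $ j)
        sums (x $ i * y $ j + (mat_pow M 0 /\<^sub>R fact 0) $ i $ j)"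
      by (subst (asm) sums_Suc_iff) simp
    then show ?thesis
      unfolding mat_exp_entry sums_iff by (simp add: add.commute)
  qed
  then show ?thesis unfolding M_def by (simp add: vec_eq_iff)
qed

text \<open>The bound \<open>\<delta>\<close> comes from \<open>exists_log_quotient\<close> and is
  uniform in \<open>x\<close>, \<open>g\<close> and \<open>h\<close>: smallness is asked only of the
  single algebra element \<open>h x - 1\<close>.\<close>

lemma exists_exp_transfer:
  "\<exists>\<delta>>0. \<forall>(x::'a::{real_normed_algebra,banach,comm_ring_1} ^ 'n) g h.
     (\<Sum>j\<in>UNIV. x $ j * g $ j) = 1 \<longrightarrow> norm ((\<Sum>j\<in>UNIV. x $ j * h $ j) - 1) < \<delta> \<longrightarrow>
     (\<exists>M. h = g v* mat_exp M)"
proof -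
  obtain \<delta> where \<delta>: "\<delta> > 0" "\<And>c::'a. norm c < \<delta> \<Longrightarrow>
      \<exists>s. (\<lambda>k. (s ^ Suc k * c ^ k) /\<^sub>R fact (Suc k)) sums 1"
    using exists_log_quotient by blast
  have "\<exists>M. h = g v* mat_exp M"
    if g: "(\<Sum>j\<in>UNIV. x $ j * g $ j) = 1" and h: "norm ((\<Sum>j\<in>UNIV. x $ j * h $ j) - 1) < \<delta>"
    for x g h :: "'a ^ 'n"
  proof -
    define c where "c = (\<Sum>j\<in>UNIV. (h - g) $ j * x $ j)"
    have "c = (\<Sum>j\<in>UNIV. x $ j * h $ j) - 1"
      unfolding c_def g[symmetric] by (simp add: sum_subtractf left_diff_distrib mult.commute[of "x $ _"])
    then obtain s where s: "(\<lambda>k. (s ^ Suc k * c ^ k) /\<^sub>R fact (Suc k)) sums 1"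
      using \<delta>(2) h by metis
    have "(g v* (\<chi> i j. x $ i * (h - g) $ j)) $ j = (\<Sum>i\<in>UNIV. x $ i * g $ i) * (h - g) $ j" for j
      by (simp add: vector_matrix_mult_def sum_distrib_left sum_distrib_right mult_ac)
    \<comment> \<open>Since \<open>g x = 1\<close>, the rank-one term sends \<open>g\<close> to
      \<open>h - g\<close>.\<close>
    then have "g v* (mat 1 + (\<chi> i j. x $ i * (h - g) $ j)) = h"
      unfolding vector_matrix_mult_add_rdistrib g by (simp add: vec_eq_iff)
    then show ?thesis
      using mat_exp_rank_one[OF c_def s] by metis
  qed
  with \<delta>(1) show ?thesis by blast
qed

section \<open>Orbits\<close>

definition Exp_orbit ::
    "'a::{real_normed_algebra,banach,comm_ring_1} ^ 'n \<Rightarrow> ('a ^ 'n) set"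
  where "Exp_orbit f = {f v* E | E. E \<in> Exp_matrices}"

lemma Exp_orbit_refl: "f \<in> Exp_orbit f"
proof -
  have "mat 1 \<in> Exp_matrices"
    unfolding Exp_matrices_def by (auto intro: exI[of _ "[]"])
  then show ?thesis
    unfolding Exp_orbit_def by (force simp: vector_matrix_mul_rid)
qed

lemma Exp_orbit_trans: "g \<in> Exp_orbit f \<Longrightarrow> h \<in> Exp_orbit g \<Longrightarrow> h \<in> Exp_orbit f"
  unfolding Exp_orbit_def by (auto simp: vector_matrix_mul_assoc intro: Exp_matrices_mult)

lemma Exp_orbit_sym: "g \<in> Exp_orbit f \<Longrightarrow> f \<in> Exp_orbit g"
  unfolding Exp_orbit_def
  by clarify (metis Exp_matrices_inverse vector_matrix_mul_assoc vector_matrix_mul_rid)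

lemma Exp_orbit_subset_unimodular:
  "f \<in> unimodular_tuples \<Longrightarrow> Exp_orbit f \<subseteq> unimodular_tuples"
  unfolding Exp_orbit_def by (auto intro: unimodular_tuples_mult_Exp)

text \<open>Fix a witness \<open>x\<close> for a point \<open>g\<close> of the orbit. The set
  \<open>V\<close> of all \<open>h\<close> with \<open>h x\<close> close to 1 is open in the whole
  space of tuples, and each such \<open>h\<close> is \<open>g\<close> times one exponential.\<close>

lemma open_Exp_orbit:
  fixes f :: "'a::{real_normed_algebra,banach,comm_ring_1} ^ 'n"
  assumes f: "f \<in> unimodular_tuples"
  shows "open (Exp_orbit f)"
proof (subst open_subopen, intro ballI)
  obtain \<delta> where \<delta>: "\<delta> > 0" "\<And>(x::'a ^ 'n) g h. (\<Sum>j\<in>UNIV. x $ j * g $ j) = 1 \<Longrightarrow>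
      norm ((\<Sum>j\<in>UNIV. x $ j * h $ j) - 1) < \<delta> \<Longrightarrow> \<exists>M. h = g v* mat_exp M"
    using exists_exp_transfer[where 'a = 'a and 'n = 'n] by blast
  fix g assume g: "g \<in> Exp_orbit f"
  then obtain x where x: "(\<Sum>j\<in>UNIV. x $ j * g $ j) = 1"
    using Exp_orbit_subset_unimodular[OF f] by (auto simp: unimodular_tuples_def)
  define V where "V = {h :: 'a ^ 'n. norm ((\<Sum>j\<in>UNIV. x $ j * h $ j) - 1) < \<delta>}"
  have "open V"
    unfolding V_def by (intro open_Collect_less continuous_intros)
  moreover have "g \<in> V" using x \<delta>(1) by (simp add: V_def)
  moreover have "V \<subseteq> Exp_orbit f"
  proof
    fix h assume "h \<in> V"
    then obtain M where "h = g v* mat_exp M" using \<delta>(2)[OF x] by (auto simp: V_def)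
    then have "h \<in> Exp_orbit g" using mat_exp_in_Exp_matrices unfolding Exp_orbit_def by blast
    with g show "h \<in> Exp_orbit f" by (rule Exp_orbit_trans)
  qed
  ultimately show "\<exists>T. open T \<and> g \<in> T \<and> T \<subseteq> Exp_orbit f" by blast
qed

lemma path_component_Exp_orbit:
  assumes "g \<in> Exp_orbit f"
  shows "path_component (Exp_orbit f) f g"
proof -
  obtain Ms where g: "g = f v* exp_prod Ms"
    using assms unfolding Exp_orbit_def Exp_matrices_def by blast
  define p where "p t = f v* exp_prod (map ((*\<^sub>R) t) Ms)" for t :: real
  have id: "map ((*\<^sub>R) 1) Ms = Ms" by (simp add: map_idI)
  have "path p"
    unfolding path_def p_def by (intro continuous_on_vector_matrix_mult continuous_on_exp_prod_line)
  moreover have "path_image p \<subseteq> Exp_orbit f"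
    unfolding path_image_def p_def Exp_orbit_def Exp_matrices_def by blast
  moreover have "pathstart p = f"
    by (simp add: pathstart_def p_def exp_prod_line_0)
  moreover have "pathfinish p = g"
    by (simp add: pathfinish_def p_def g id)
  ultimately show ?thesis unfolding path_component_def by blast
qed

lemma path_connected_Exp_orbit: "path_connected (Exp_orbit f)"
  unfolding path_connected_component
  by (meson path_component_Exp_orbit path_component_sym path_component_trans)

theorem theorem2p2:
  fixes f :: "'a::{real_normed_algebra,banach,comm_ring_1} ^ 'n"
  assumes "f \<in> unimodular_tuples"
  shows "connected_component_set unimodular_tuples f = {f v* E | E. E \<in> Exp_matrices}
       \<and> path_connected (connected_component_set unimodular_tuples f)"
proof -
  let ?C = "connected_component_set unimodular_tuples f"
  \<comment> \<open>The union of all other orbits. It is open and disjoint from the orbit of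
    \<open>f\<close>, and together they cover the unimodular tuples, so the connected set
    \<open>?C\<close>, which contains \<open>f\<close>, cannot meet \<open>W\<close>.\<close>
  define W where "W = (\<Union>g \<in> unimodular_tuples - Exp_orbit f. Exp_orbit g)"
  have W: "W \<inter> Exp_orbit f = {}"
    unfolding W_def using Exp_orbit_sym Exp_orbit_trans by blast
  have "open W"
    unfolding W_def by (intro open_UN ballI open_Exp_orbit) auto
  moreover have "?C \<subseteq> Exp_orbit f \<union> W"
    using connected_component_subset[of unimodular_tuples f] Exp_orbit_refl unfolding W_def by blast
  moreover have "f \<in> ?C" using assms by (simp add: connected_component_refl_eq)
  ultimately have "?C \<inter> W = {}"
    using connectedD[OF connected_connected_component open_Exp_orbit[OF assms] \<open>open W\<close>,
        of unimodular_tuples f] W Exp_orbit_refl[of f] by blast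
  with \<open>?C \<subseteq> Exp_orbit f \<union> W\<close> have "?C \<subseteq> Exp_orbit f" by blast
  \<comment> \<open>The orbit is path-connected, contains \<open>f\<close> and lies in the
    unimodular tuples, so maximality of the component applies.\<close>
  moreover have "Exp_orbit f \<subseteq> ?C"
    by (intro connected_component_maximal Exp_orbit_refl Exp_orbit_subset_unimodular assms
        path_connected_imp_connected path_connected_Exp_orbit)
  ultimately have "?C = Exp_orbit f" by blast
  then show ?thesis
    using path_connected_Exp_orbit[of f] by (simp add: Exp_orbit_def)
qed

end
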